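(* Let $\mathfrak g$ be a unimodular four dimensional Kähler Lie algebra with pseudo-Kähler metric $g$. Then $g$ is flat and its Levi-Civita connection is (geodesically) complete.
   Context: All Lie algebras are real. $\mathfrak g$ is unimodular if $\operatorname{tr}(\operatorname{ad}_x)=0$ for all $x\in\mathfrak g$. A complex structure on $\mathfrak g$ is an endomorphism $J$ with $J^2=-I$ and $[Jx,Jy]-[x,y]-J[Jx,y]-J[x,Jy]=0$. A Kähler Lie algebra is a Lie algebra with a complex structure $J$ and a closed nondegenerate 2-form $\omega$ (closed: $\omega([x,y],z)+\omega([y,z],x)+\omega([z,x],y)=0$) with $\omega(Jx,Jy)=\omega(x,y)$; the associated pseudo-Kähler metric is $g(x,y)=\omega(Jx,y)$ (not necessarily definite). The Levi-Civita connection is given by $2g(\nabla_xy,z)=g([x,y],z)-g([y,z],x)+g([z,x],y)$, the curvature by $R(x,y)=[\nabla_x,\nabla_y]-\nabla_{[x,y]}$, and $g$ is flat if $R\equiv0$. The connection is complete if the left invariant connection induced on the simply connected Lie group with Lie algebra $\mathfrak g$ is geodesically complete; equivalently, every solution of $\dot x(t)=-\nabla_{x(t)}x(t)$ in $\mathfrak g$ is defined for all $t\in\mathbb R$. *)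

theory Defs
  imports "HOL-Analysis.Analysis"
begin

text \<open>
  A finite-dimensional real Lie algebra is a bracket on a type of class
  \<open>euclidean_space\<close>. The inner product and norm of that class are auxiliary: they only
  provide a basis (for traces) and the topology (for derivatives of curves). No
  compatibility with the bracket is assumed, and the notions below do not depend on them.
\<close>

locale lie_algebra =
  fixes br :: "'a::euclidean_space \<Rightarrow> 'a \<Rightarrow> 'a"
  assumes bilinear_br: "bilinear br"
    and br_self: "br x x = 0"
    and jacobi: "br x (br y z) + br y (br z x) + br z (br x y) = 0"

text \<open>The basis of the type is orthonormal, so the inner product with a basis vector is a coordinate.\<close>

definition endo_trace :: "('a::euclidean_space \<Rightarrow> 'a) \<Rightarrow> real" where
  "endo_trace f = (\<Sum>b\<in>Basis. f b \<bullet> b)"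

definition unimodular :: "('a::euclidean_space \<Rightarrow> 'a \<Rightarrow> 'a) \<Rightarrow> bool" where
  "unimodular br \<longleftrightarrow> (\<forall>x. endo_trace (\<lambda>y. br x y) = 0)"

locale kahler_lie_algebra = lie_algebra br
  for br :: "'a::euclidean_space \<Rightarrow> 'a \<Rightarrow> 'a" +
  fixes J :: "'a \<Rightarrow> 'a"
    and \<omega> :: "'a \<Rightarrow> 'a \<Rightarrow> real"
  assumes linear_J: "linear J"
    and J_J: "J (J x) = - x"
    and integrable_J: "br (J x) (J y) - br x y - J (br (J x) y) - J (br x (J y)) = 0"
    and bilinear_form: "bilinear \<omega>"
    and alternating_form: "\<omega> x x = 0"
    and nondegenerate_form: "(\<And>y. \<omega> x y = 0) \<Longrightarrow> x = 0"
    and closed_form: "\<omega> (br x y) z + \<omega> (br y z) x + \<omega> (br z x) y = 0"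
    and J_invariant_form: "\<omega> (J x) (J y) = \<omega> x y"

definition pseudo_kahler_metric ::
    "('a \<Rightarrow> 'a) \<Rightarrow> ('a \<Rightarrow> 'a \<Rightarrow> real) \<Rightarrow> 'a \<Rightarrow> 'a \<Rightarrow> real" where
  "pseudo_kahler_metric J \<omega> x y = \<omega> (J x) y"

text \<open>
  The Koszul formula; \<open>levi_civita_koszul\<close> below shows that the description is proper
  for a nondegenerate bilinear form.
\<close>

definition levi_civita ::
    "('a \<Rightarrow> 'a \<Rightarrow> 'a) \<Rightarrow> ('a \<Rightarrow> 'a \<Rightarrow> real) \<Rightarrow> 'a::euclidean_space \<Rightarrow> 'a \<Rightarrow> 'a" where
  "levi_civita br g x y =
     (THE w. \<forall>z. 2 * g w z = g (br x y) z - g (br y z) x + g (br z x) y)"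

definition curvature ::
    "('a \<Rightarrow> 'a \<Rightarrow> 'a) \<Rightarrow> ('a \<Rightarrow> 'a \<Rightarrow> 'a) \<Rightarrow> 'a::euclidean_space \<Rightarrow> 'a \<Rightarrow> 'a \<Rightarrow> 'a" where
  "curvature br nabla x y z =
     nabla x (nabla y z) - nabla y (nabla x z) - nabla (br x y) z"

definition flat_metric ::
    "('a \<Rightarrow> 'a \<Rightarrow> 'a) \<Rightarrow> ('a::euclidean_space \<Rightarrow> 'a \<Rightarrow> real) \<Rightarrow> bool" where
  "flat_metric br g \<longleftrightarrow> (\<forall>x y z. curvature br (levi_civita br g) x y z = 0)"

text \<open>
  Geodesic completeness of the left invariant connection on the simply connected group,
  expressed on the Lie algebra: every solution of \<open>x' = - nabla x x\<close> on an open interval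
  extends to a solution on the whole real line.
\<close>

definition geodesic_on ::
    "('a \<Rightarrow> 'a \<Rightarrow> 'a) \<Rightarrow> real set \<Rightarrow> (real \<Rightarrow> 'a::euclidean_space) \<Rightarrow> bool" where
  "geodesic_on nabla S x \<longleftrightarrow>
     (\<forall>t\<in>S. (x has_vector_derivative - nabla (x t) (x t)) (at t))"

definition geodesically_complete ::
    "('a::euclidean_space \<Rightarrow> 'a \<Rightarrow> 'a) \<Rightarrow> bool" where
  "geodesically_complete nabla \<longleftrightarrow>
     (\<forall>S x. open S \<and> is_interval S \<and> geodesic_on nabla S x \<longrightarrow>
        (\<exists>y. geodesic_on nabla UNIV y \<and> (\<forall>t\<in>S. y t = x t)))"

lemma nondegenerate_represents:
  fixes g :: "'a::euclidean_space \<Rightarrow> 'a \<Rightarrow> real"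
  assumes g: "bilinear g" and nd: "\<And>x. (\<And>y. g x y = 0) \<Longrightarrow> x = 0" and f: "linear f"
  shows "\<exists>!w. \<forall>z. g w z = f z"
proof -
  have ext: "(\<forall>z. h z = k z)" if "linear h" "linear k" "\<forall>b\<in>Basis. h b = k b"
    for h k :: "'a \<Rightarrow> real"
    using linear_eq_stdbasis[OF that(1,2)] that(3) by auto
  have lin: "linear (g w)" for w using g by (simp add: bilinear_def)
  define G where "G w = (\<Sum>b\<in>Basis. g w b *\<^sub>R b)" for w
  have G_coord: "G w \<bullet> b = g w b" if "b \<in> Basis" for w b
    using that unfolding G_def by simp
  have linG: "linear G"
    by (rule linearI)
      (simp_all add: G_def bilinear_ladd[OF g] bilinear_lmul[OF g] scaleR_add_left
        sum.distrib scaleR_sum_right)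
  have injG: "inj G"
    unfolding linear_injective_0[OF linG]
  proof (intro allI impI)
    fix w assume "G w = 0"
    then have "\<forall>b\<in>Basis. g w b = 0" using G_coord by (metis inner_zero_left)
    then have "\<forall>z. g w z = 0" using ext[OF lin, of "\<lambda>_. 0"] by (simp add: linear_iff)
    then show "w = 0" using nd by blast
  qed
  have "surj G" by (rule linear_injective_imp_surjective[OF linG injG]) simp
  then obtain w where "G w = (\<Sum>b\<in>Basis. f b *\<^sub>R b)" by (metis surjD)
  then have "\<forall>b\<in>Basis. g w b = f b"
    using G_coord[of _ w] by (metis inner_sum_left_Basis)
  then have w: "\<forall>z. g w z = f z" using ext[OF lin f] by blast
  show ?thesis
  proof (rule ex1I[of _ w])
    fix v assume v: "\<forall>z. g v z = f z"
    have "g (v - w) z = 0" for z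
      using v w by (simp add: bilinear_lsub[OF g])
    then show "v = w" using nd[of "v - w"] by simp
  qed (fact w)
qed

lemma levi_civita_koszul:
  fixes br :: "'a::euclidean_space \<Rightarrow> 'a \<Rightarrow> 'a"
  assumes br: "bilinear br" and g: "bilinear g" and nd: "\<And>x. (\<And>y. g x y = 0) \<Longrightarrow> x = 0"
  shows "2 * g (levi_civita br g x y) z = g (br x y) z - g (br y z) x + g (br z x) y"
proof -
  have "linear (\<lambda>z. (g (br x y) z - g (br y z) x + g (br z x) y) / 2)"
    by (rule linearI)
      (simp_all add: bilinear_ladd[OF g] bilinear_radd[OF g] bilinear_lmul[OF g]
        bilinear_rmul[OF g] bilinear_ladd[OF br] bilinear_radd[OF br] bilinear_lmul[OF br]
        bilinear_rmul[OF br] field_simps)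
  from nondegenerate_represents[OF g nd this]
  have "\<exists>!w. \<forall>z. 2 * g w z = g (br x y) z - g (br y z) x + g (br z x) y"
    by (simp add: field_simps)
  from theI'[OF this] show ?thesis unfolding levi_civita_def by blast
qed

lemma (in kahler_lie_algebra) pseudo_kahler_koszul:
  defines "g \<equiv> pseudo_kahler_metric J \<omega>"
  shows "2 * g (levi_civita br g x y) z = g (br x y) z - g (br y z) x + g (br z x) y"
proof (rule levi_civita_koszul[OF bilinear_br])
  show "bilinear g"
    unfolding g_def pseudo_kahler_metric_def bilinear_def linear_iff
    by (simp add: bilinear_ladd[OF bilinear_form] bilinear_radd[OF bilinear_form]
        bilinear_lmul[OF bilinear_form] bilinear_rmul[OF bilinear_form]
        linear_add[OF linear_J] linear_cmul[OF linear_J])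
  show "x = 0" if "\<And>y. g x y = 0" for x
  proof -
    have "J x = 0"
      using that nondegenerate_form[of "J x"] by (simp add: g_def pseudo_kahler_metric_def)
    then have "J (J x) = 0" by (simp add: linear_0[OF linear_J])
    then show ?thesis by (simp add: J_J)
  qed
qed

end

theory Submission
  imports Defs
begin

text \<open>
  The derived algebra is so small, and the complex structure acts on it in so rigid a way,
  that the Levi-Civita connection can be written down.

  On a unimodular Lie algebra of dimension four every \<open>3\<close>-form is closed, so the wedge product
  of an exact and a closed \<open>2\<close>-form vanishes. Hence the space of exact \<open>2\<close>-forms is isotropic
  for the wedge pairing and orthogonal to \<open>\<omega>\<close>, whose square is not zero; the pairing has
  signature \<open>(3,3)\<close>, so there are at most two independent exact \<open>2\<close>-forms, and the derived
  algebra has dimension at most \<open>2\<close>. In a frame \<open>e, J e, f, J f\<close> adapted to \<open>\<omega>\<close>, the two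
  orthogonality relations combine with integrability to one equality between signed sums of squares
  in which \<open>B\<close> and \<open>J B\<close>, for a certain sum \<open>B\<close> of two brackets, stand against the other brackets. It
  shows more: the derived algebra lies in a complex line \<open>span {b, J b}\<close>
  (lemma \<open>derived_algebra_in_complex_line\<close>).

  Unimodularity makes all \<open>ad x\<close> traceless on this line, the line is abelian, so they
  commute there, and integrability relates \<open>ad (J x)\<close> to \<open>ad x\<close>. Together this leaves only
  \<open>[x, v] = a x *\<^sub>R J v\<close> on the line, with a linear form \<open>a\<close> that vanishes on the line
  (lemma \<open>derived_line_action\<close>).

  Two cases remain. If the line is isotropic for \<open>\<omega>\<close>, closedness forces \<open>a = 0\<close>; the line is
  central and its own orthogonal, \<open>\<nabla>\<close> takes its values in it and vanishes when either
  argument lies in it (in examples: the Heisenberg algebra plus a line). If the line is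
  nondegenerate, its orthogonal complement is an abelian subalgebra and \<open>\<nabla>\<^sub>x y = a x *\<^sub>R J (P y)\<close>
  with \<open>P\<close> the orthogonal projection to the line (in examples: the motions of the plane plus a
  line). In both cases the operators \<open>\<nabla>\<^sub>x\<close> commute, \<open>\<nabla>\<^sub>w = 0\<close> for \<open>w = \<nabla>\<^sub>x y\<close>, and the cube of \<open>\<nabla>\<^sub>x\<close> is \<open>- c\<^sup>2\<close> times
  \<open>\<nabla>\<^sub>x\<close>.

  Flatness follows, as \<open>[x, y] = \<nabla>\<^sub>x y - \<nabla>\<^sub>y x\<close> also acts by zero. Along a geodesic
  the derivative \<open>x' = - \<nabla>\<^sub>x x\<close> is a value of \<open>\<nabla>\<close>, so the operator \<open>\<nabla>\<^sub>x\<close> is constant and the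
  equation is linear with constant coefficients; the cubic relation makes its flow explicit.
\<close>

section \<open>Linear algebra\<close>

lemma mem_span_if_annihilated:
  fixes v :: "'a::euclidean_space"
  assumes "\<And>z. (\<forall>s\<in>S. z \<bullet> s = 0) \<Longrightarrow> z \<bullet> v = 0"
  shows "v \<in> span S"
proof -
  obtain y z where y: "y \<in> span S" and z: "\<And>w. w \<in> span S \<Longrightarrow> orthogonal z w" and v: "v = y + z"
    using orthogonal_subspace_decomp_exists[of S v] by metis
  have "z \<bullet> v = 0" using assms[of z] z by (auto simp: orthogonal_def span_base)
  moreover have "z \<bullet> y = 0" using z y by (simp add: orthogonal_def)
  ultimately have "z = 0" by (simp add: v inner_add_right)
  then show ?thesis using y v by simp
qed

lemma endo_trace_add: "endo_trace (\<lambda>x. f x + g x) = endo_trace f + endo_trace g"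
  by (simp add: endo_trace_def inner_add_left sum.distrib)

text \<open>
  Since traces are sums over the orthonormal basis of the type, they are computed in other
  bases by writing an operator as a sum of operators of rank one.
\<close>

lemma endo_trace_rank_one:
  fixes \<phi> :: "'a::euclidean_space \<Rightarrow> real"
  assumes "linear \<phi>"
  shows "endo_trace (\<lambda>x. \<phi> x *\<^sub>R e) = \<phi> e"
proof -
  have "\<phi> e = \<phi> (\<Sum>b\<in>Basis. (e \<bullet> b) *\<^sub>R b)" by (simp add: euclidean_representation)
  also have "\<dots> = (\<Sum>b\<in>Basis. (e \<bullet> b) * \<phi> b)"
    by (simp add: linear_sum[OF assms] linear_cmul[OF assms])
  finally show ?thesis by (simp add: endo_trace_def mult.commute)
qed

section \<open>Unimodular Lie algebras of dimension four\<close>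

context lie_algebra
begin

lemmas br_linear =
  bilinear_ladd[OF bilinear_br] bilinear_radd[OF bilinear_br]
  bilinear_lmul[OF bilinear_br] bilinear_rmul[OF bilinear_br]
  bilinear_lneg[OF bilinear_br] bilinear_rneg[OF bilinear_br]
  bilinear_lsub[OF bilinear_br] bilinear_rsub[OF bilinear_br]

lemma br_swap: "br y x = - br x y"
proof -
  have "br (x + y) (x + y) = br x x + br x y + (br y x + br y y)"
    by (simp only: br_linear ac_simps)
  then have "br y x + br x y = 0" by (simp add: br_self add.commute)
  then show ?thesis by (simp add: eq_neg_iff_add_eq_0)
qed

lemma linear_coordinate_ad:
  fixes \<phi> :: "'a \<Rightarrow> real"
  assumes "linear \<phi>"
  shows "linear (\<lambda>y. \<phi> (br x y))"
  by (rule linearI) (simp_all add: br_linear linear_add[OF assms] linear_cmul[OF assms])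

lemma unimodular_coordinates:
  assumes "unimodular br"
    and lin: "linear \<phi>1" "linear \<phi>2" "linear \<phi>3" "linear \<phi>4"
    and expand: "\<And>x. x = \<phi>1 x *\<^sub>R e1 + \<phi>2 x *\<^sub>R e2 + \<phi>3 x *\<^sub>R e3 + \<phi>4 x *\<^sub>R e4"
  shows "\<phi>1 (br x e1) + \<phi>2 (br x e2) + \<phi>3 (br x e3) + \<phi>4 (br x e4) = 0"
proof -
  have "endo_trace (\<lambda>y. br x y) = endo_trace (\<lambda>y. \<phi>1 (br x y) *\<^sub>R e1 + \<phi>2 (br x y) *\<^sub>R e2
      + \<phi>3 (br x y) *\<^sub>R e3 + \<phi>4 (br x y) *\<^sub>R e4)"
    by (rule arg_cong[where f = endo_trace], rule ext) (rule expand)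
  then show ?thesis
    using assms(1) by (simp add: unimodular_def endo_trace_add endo_trace_rank_one linear_coordinate_ad lin)
qed

text \<open>
  With \<open>\<lambda> x = z \<bullet> x\<close>, the left-hand side is the coefficient of \<open>d\<lambda> \<and> d\<lambda>\<close>. It vanishes because
  \<open>d\<lambda> \<and> d\<lambda> = d (\<lambda> \<and> d\<lambda>)\<close>, where \<open>d d\<lambda> = 0\<close> is the Jacobi identity, and because \<open>d\<close> of a \<open>3\<close>-form is a
  combination of the traces of the operators \<open>ad x\<close>.
\<close>

lemma exact_form_square_zero:
  assumes uni: "unimodular br"
    and lin: "linear \<phi>1" "linear \<phi>2" "linear \<phi>3" "linear \<phi>4"
    and expand: "\<And>x. x = \<phi>1 x *\<^sub>R e1 + \<phi>2 x *\<^sub>R e2 + \<phi>3 x *\<^sub>R e3 + \<phi>4 x *\<^sub>R e4"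
  shows "(z \<bullet> br e1 e2) * (z \<bullet> br e3 e4) - (z \<bullet> br e1 e3) * (z \<bullet> br e2 e4)
    + (z \<bullet> br e1 e4) * (z \<bullet> br e2 e3) = 0"
proof -
  define l1 l2 l3 l4 where l_def: "l1 = z \<bullet> e1" "l2 = z \<bullet> e2" "l3 = z \<bullet> e3" "l4 = z \<bullet> e4"
  define L12 L13 L14 L23 L24 L34 where L_def:
    "L12 = z \<bullet> br e1 e2" "L13 = z \<bullet> br e1 e3" "L14 = z \<bullet> br e1 e4"
    "L23 = z \<bullet> br e2 e3" "L24 = z \<bullet> br e2 e4" "L34 = z \<bullet> br e3 e4"
  have inner_expand: "z \<bullet> x = \<phi>1 x * l1 + \<phi>2 x * l2 + \<phi>3 x * l3 + \<phi>4 x * l4" for x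
    by (subst expand[of x]) (simp add: inner_add_right l_def)
  note L = inner_expand[of "br e1 e2"] inner_expand[of "br e1 e3"] inner_expand[of "br e1 e4"]
    inner_expand[of "br e2 e3"] inner_expand[of "br e2 e4"] inner_expand[of "br e3 e4"]
  have inner_br: "z \<bullet> br x y = \<phi>1 y * (z \<bullet> br x e1) + \<phi>2 y * (z \<bullet> br x e2)
      + \<phi>3 y * (z \<bullet> br x e3) + \<phi>4 y * (z \<bullet> br x e4)" for x y
    by (subst expand[of y]) (simp add: inner_add_right br_linear)
  have swap: "br e2 e1 = - br e1 e2" "br e3 e1 = - br e1 e3" "br e4 e1 = - br e1 e4"
    "br e3 e2 = - br e2 e3" "br e4 e2 = - br e2 e4" "br e4 e3 = - br e3 e4"
    by (rule br_swap)+
  note neg = lin[THEN linear_neg] lin[THEN linear_0]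
  define j where "j x y w = z \<bullet> br x (br y w) + z \<bullet> br y (br w x) + z \<bullet> br w (br x y)" for x y w
  have j: "j x y w = 0" for x y w
    using arg_cong[OF jacobi[of x y w], of "\<lambda>v. z \<bullet> v"] by (simp add: inner_add_right j_def)
  define t where "t x = \<phi>1 (br x e1) + \<phi>2 (br x e2) + \<phi>3 (br x e3) + \<phi>4 (br x e4)" for x
  have t: "t x = 0" for x
    unfolding t_def by (rule unimodular_coordinates[OF uni lin expand])
  \<comment> \<open>The Jacobi terms are the coefficient of \<open>\<lambda> \<and> d d\<lambda>\<close>; the trace terms pair the traces
    with the coefficients of \<open>\<lambda> \<and> d\<lambda>\<close>.\<close>
  have "2 * (L12 * L34 - L13 * L24 + L14 * L23) =
      - l1 * j e2 e3 e4 + l2 * j e1 e3 e4 - l3 * j e1 e2 e4 + l4 * j e1 e2 e3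
      + t e1 * (l2 * L34 - l3 * L24 + l4 * L23) - t e2 * (l1 * L34 - l3 * L14 + l4 * L13)
      + t e3 * (l1 * L24 - l2 * L14 + l4 * L12) - t e4 * (l1 * L23 - l2 * L13 + l3 * L12)"
    unfolding j_def t_def swap inner_br[of _ "- _"] inner_br[of _ "br _ _"]
    by (simp add: br_self neg inner_minus_right flip: L_def) (simp add: L_def L algebra_simps)
  then show ?thesis by (simp add: j t L_def)
qed

end

section \<open>A frame adapted to the complex structure\<close>

lemma dim_span_pair_le: "dim (span {a, b}) \<le> 2"
  using dim_le_card'[of "{a, b}"] card_insert_le_m1[of 2 "{b}" a] by (simp add: dim_span)

context kahler_lie_algebra
begin

lemmas J_linear =
  linear_add[OF linear_J] linear_cmul[OF linear_J] linear_neg[OF linear_J]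
  linear_diff[OF linear_J] linear_0[OF linear_J] J_J

lemmas form_linear =
  bilinear_ladd[OF bilinear_form] bilinear_radd[OF bilinear_form]
  bilinear_lmul[OF bilinear_form] bilinear_rmul[OF bilinear_form]
  bilinear_lneg[OF bilinear_form] bilinear_rneg[OF bilinear_form]
  bilinear_lsub[OF bilinear_form] bilinear_rsub[OF bilinear_form]
  bilinear_lzero[OF bilinear_form] bilinear_rzero[OF bilinear_form]

lemma form_swap: "\<omega> y x = - \<omega> x y"
proof -
  have "\<omega> (x + y) (x + y) = \<omega> x x + \<omega> x y + (\<omega> y x + \<omega> y y)"
    by (simp only: form_linear ac_simps)
  then show ?thesis by (simp add: alternating_form)
qed

lemma form_J_left: "\<omega> (J x) y = - \<omega> x (J y)"
  using J_invariant_form[of x "J y"] by (simp add: J_linear form_linear)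

lemma linear_form_coordinate: "linear (\<lambda>x. \<omega> x c / k)" "linear (\<lambda>x. \<omega> c x / k)"
  by (rule linearI; simp add: form_linear add_divide_distrib)+

lemma form_eqI: "(\<And>y. \<omega> x y = \<omega> x' y) \<Longrightarrow> x = x'"
  using nondegenerate_form[of "x - x'"] by (simp add: form_linear)

text \<open>
  A real linear relation between \<open>b\<close> and \<open>J b\<close> says that a complex scalar annihilates \<open>b\<close>;
  multiply it by the conjugate scalar.
\<close>

lemma complex_multiple_eq_zero:
  assumes "b \<noteq> 0" and "r *\<^sub>R b + s *\<^sub>R J b = 0"
  shows "r = 0 \<and> s = 0"
proof -
  have "r *\<^sub>R (r *\<^sub>R b + s *\<^sub>R J b) - s *\<^sub>R J (r *\<^sub>R b + s *\<^sub>R J b) = (r\<^sup>2 + s\<^sup>2) *\<^sub>R b"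
    by (simp add: J_linear algebra_simps power2_eq_square)
  with assms show ?thesis by (simp add: J_linear)
qed

lemma complex_line_independent:
  assumes "b \<noteq> 0"
  shows "independent {b, J b}" and "b \<noteq> J b"
proof -
  show ne: "b \<noteq> J b"
    using complex_multiple_eq_zero[OF assms, of 1 "-1"] by auto
  show "independent {b, J b}"
  proof (rule independent_if_scalars_zero)
    fix u x assume u: "(\<Sum>x\<in>{b, J b}. u x *\<^sub>R x) = 0" and "x \<in> {b, J b}"
    then show "u x = 0"
      using complex_multiple_eq_zero[OF assms, of "u b" "u (J b)"] ne by auto
  qed simp
qed

lemma complex_line_dim:
  assumes "b \<noteq> 0"
  shows "dim (span {b, J b}) = 2"
  using complex_line_independent[OF assms] by (simp add: dim_eq_card_independent)

lemma complex_line_J: "v \<in> span {b, J b} \<Longrightarrow> J v \<in> span {b, J b}"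
  unfolding span_insert span_singleton
  by (auto simp: J_linear algebra_simps)
    (metis add.commute add_minus_cancel diff_minus_eq_add scaleR_minus_left)

lemma complex_line_coordinates:
  assumes "b \<noteq> 0"
  obtains \<alpha> \<beta> :: "'a \<Rightarrow> real"
  where "linear \<alpha>" "linear \<beta>" "\<And>v. v \<in> span {b, J b} \<Longrightarrow> v = \<alpha> v *\<^sub>R b + \<beta> v *\<^sub>R J b"
proof -
  note ind = complex_line_independent(1)[OF assms] and ne = complex_line_independent(2)[OF assms]
  obtain \<alpha> \<beta> :: "'a \<Rightarrow> real" where lin: "linear \<alpha>" "linear \<beta>"
    and val: "\<alpha> b = 1" "\<alpha> (J b) = 0" "\<beta> b = 0" "\<beta> (J b) = 1"
    using linear_independent_extend[OF ind, of "\<lambda>x. if x = b then 1 else (0::real)"]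
      linear_independent_extend[OF ind, of "\<lambda>x. if x = b then 0 else (1::real)"] ne by auto
  have "v = \<alpha> v *\<^sub>R b + \<beta> v *\<^sub>R J b" if v: "v \<in> span {b, J b}" for v
  proof -
    obtain r s where "v = r *\<^sub>R b + s *\<^sub>R J b"
      using v unfolding span_insert by (auto simp: span_singleton algebra_simps)
    then show ?thesis
      by (simp add: linear_add[OF lin(1)] linear_add[OF lin(2)] linear_cmul[OF lin(1)]
          linear_cmul[OF lin(2)] val)
  qed
  with lin that show ?thesis by blast
qed

text \<open>
  Here \<open>\<omega> e (J e) = - g e e\<close>, so this is polarization: a symmetric form whose quadratic form
  vanishes on \<open>W\<close> is zero on \<open>W\<close>.
\<close>

lemma exists_nonnull_vector:
  assumes W: "subspace W" "J ` W \<subseteq> W" and xy: "x \<in> W" "y \<in> W" "\<omega> x y \<noteq> 0"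
  shows "\<exists>e\<in>W. \<omega> e (J e) \<noteq> 0"
proof (rule ccontr)
  assume "\<not> ?thesis"
  then have null: "\<omega> e (J e) = 0" if "e \<in> W" for e using that by blast
  \<comment> \<open>The metric pairs \<open>x\<close> with \<open>J y\<close> as \<open>\<omega>\<close> pairs \<open>x\<close> with \<open>y\<close>, up to sign.\<close>
  have v: "J y \<in> W" using W xy by blast
  have "\<omega> (x + J y) (J (x + J y)) = 0"
    using null[of "x + J y"] subspace_add[OF W(1) xy(1) v] by blast
  moreover have "\<omega> (J y) (J x) = - \<omega> x y"
    by (simp add: J_invariant_form form_swap[of y x])
  ultimately show False
    using null[OF xy(1)] null[OF v] xy(3) by (simp add: form_linear J_linear)
qed

text \<open>
  The complex lines of \<open>e\<close> and \<open>f\<close> are nondegenerate and orthogonal; the products of \<open>J e\<close> with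
  \<open>f\<close> and \<open>J f\<close> vanish by invariance. The values \<open>\<omega> e (J e)\<close> and \<open>\<omega> f (J f)\<close> may differ in sign, as
  the metric may be indefinite.
\<close>

definition adapted_frame :: "'a \<Rightarrow> 'a \<Rightarrow> bool" where
  "adapted_frame e f \<longleftrightarrow> \<omega> e (J e) \<noteq> 0 \<and> \<omega> f (J f) \<noteq> 0 \<and> \<omega> e f = 0 \<and> \<omega> e (J f) = 0"

lemma adapted_frame_exists:
  assumes dim: "DIM('a) = 4"
  shows "\<exists>e f. adapted_frame e f"
proof -
  obtain x0 :: 'a where x0: "x0 \<in> Basis" using nonempty_Basis by blast
  then obtain y0 where "\<omega> x0 y0 \<noteq> 0" using nondegenerate_form[of x0] nonzero_Basis by blast
  then obtain e where e: "\<omega> e (J e) \<noteq> 0"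
    using exists_nonnull_vector[of UNIV x0 y0] by auto
  define W where "W = {x. \<omega> e x = 0 \<and> \<omega> e (J x) = 0}"
  have subW: "subspace W"
    by (auto simp: subspace_def W_def form_linear J_linear)
  have JW: "J ` W \<subseteq> W"
    by (auto simp: W_def J_linear form_linear)
  \<comment> \<open>the projection along the complex line of \<open>e\<close> to its orthogonal complement\<close>
  define Q where "Q x = x - (\<omega> x (J e) / \<omega> e (J e)) *\<^sub>R e - (\<omega> e x / \<omega> e (J e)) *\<^sub>R J e" for x
  have QW: "Q x \<in> W" for x
    using e by (simp add: W_def Q_def form_linear J_linear alternating_form form_J_left
        form_swap[of x "J e"])
  have "\<exists>x\<in>W. \<exists>y\<in>W. \<omega> x y \<noteq> 0"
  proof (rule ccontr)
    assume *: "\<not> ?thesis"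
    have "Q x = 0" for x
    proof (rule nondegenerate_form)
      fix y
      have "\<omega> w e = 0" "\<omega> w (J e) = 0" if "w \<in> W" for w
        using that form_J_left[of e w] by (simp_all add: W_def form_swap[of w])
      then have "\<omega> (Q x) y = \<omega> (Q x) (Q y)"
        using QW[of x] by (simp add: Q_def[of y] form_linear)
      then show "\<omega> (Q x) y = 0" using * QW by metis
    qed
    then have "x = (\<omega> x (J e) / \<omega> e (J e)) *\<^sub>R e + (\<omega> e x / \<omega> e (J e)) *\<^sub>R J e" for x
      unfolding Q_def by (simp add: algebra_simps)
    then have "x \<in> span {e, J e}" for x
      by (metis span_add span_base span_mul insertI1 insertI2)
    then have "span {e, J e} = (UNIV :: 'a set)" by auto
    then show False using dim dim_span_pair_le[of e "J e"] by simp
  qed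
  then obtain f where "f \<in> W" "\<omega> f (J f) \<noteq> 0"
    using exists_nonnull_vector[OF subW JW] by blast
  with e show ?thesis unfolding W_def adapted_frame_def by auto
qed

lemma adapted_frame_expansion:
  assumes dim: "DIM('a) = 4" and frame: "adapted_frame e f"
  shows "x = (\<omega> x (J e) / \<omega> e (J e)) *\<^sub>R e + (\<omega> e x / \<omega> e (J e)) *\<^sub>R J e
    + (\<omega> x (J f) / \<omega> f (J f)) *\<^sub>R f + (\<omega> f x / \<omega> f (J f)) *\<^sub>R J f" (is "x = ?P x")
proof -
  \<comment> \<open>The coordinate map is surjective, hence injective for reasons of dimension.\<close>
  define F where "F x = (\<omega> x (J e) / \<omega> e (J e), \<omega> e x / \<omega> e (J e), \<omega> x (J f) / \<omega> f (J f), \<omega> f x / \<omega> f (J f))" for x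
  have linF: "linear F"
    by (rule linearI) (simp_all add: F_def form_linear add_divide_distrib)
  have nz: "\<omega> e (J e) \<noteq> 0" "\<omega> f (J f) \<noteq> 0" and orth: "\<omega> e f = 0" "\<omega> e (J f) = 0" "\<omega> f e = 0" "\<omega> f (J e) = 0"
    using frame form_J_left[of e f] by (simp_all add: adapted_frame_def form_swap[of f])
  have F_comb: "F (a *\<^sub>R e + b *\<^sub>R J e + c *\<^sub>R f + d *\<^sub>R J f) = (a, b, c, d)" for a b c d
    using nz by (simp add: F_def form_linear form_J_left J_linear orth alternating_form)
  then have "surj F" by (metis surj_def prod_cases4)
  then have "inj F"
    by (rule linear_surjective_imp_injective[OF linF]) (simp add: dim)
  moreover have "F (?P x) = F x" by (subst F_comb) (simp add: F_def)
  ultimately show ?thesis by (metis injD)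
qed

section \<open>The derived algebra lies in a complex line\<close>

text \<open>
  This is \<open>d\<lambda> \<and> \<omega> = 0\<close> for all linear forms \<open>\<lambda>\<close>. Closedness turns the part of the trace of \<open>ad x\<close>
  that comes from \<open>span {v, J v}\<close> into a multiple of \<open>\<omega> [v, J v] x\<close>.
\<close>

lemma adapted_frame_contraction:
  assumes dim: "DIM('a) = 4" and uni: "unimodular br" and frame: "adapted_frame e f"
  shows "\<omega> f (J f) *\<^sub>R br e (J e) + \<omega> e (J e) *\<^sub>R br f (J f) = 0"
proof (rule nondegenerate_form)
  fix x
  have nz: "\<omega> e (J e) \<noteq> 0" "\<omega> f (J f) \<noteq> 0"
    using frame by (simp_all add: adapted_frame_def)
  note lin = linear_form_coordinate
  have cl: "\<omega> (br x v) (J v) + \<omega> v (br x (J v)) = - \<omega> (br v (J v)) x" for v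
    using closed_form[of x v "J v"] br_swap[of x "J v"] form_swap[of "br x (J v)" v]
    by (simp add: form_linear)
  have "\<omega> (br x e) (J e) / \<omega> e (J e) + \<omega> e (br x (J e)) / \<omega> e (J e)
      + \<omega> (br x f) (J f) / \<omega> f (J f) + \<omega> f (br x (J f)) / \<omega> f (J f) = 0"
    by (rule unimodular_coordinates[OF uni lin(1) lin(2) lin(1) lin(2) adapted_frame_expansion[OF dim frame]])
  then have "(\<omega> (br x e) (J e) + \<omega> e (br x (J e))) / \<omega> e (J e)
      + (\<omega> (br x f) (J f) + \<omega> f (br x (J f))) / \<omega> f (J f) = 0"
    by (simp add: add_divide_distrib)
  then have "- \<omega> (br e (J e)) x / \<omega> e (J e) - \<omega> (br f (J f)) x / \<omega> f (J f) = 0"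
    unfolding cl by simp
  then show "\<omega> (\<omega> f (J f) *\<^sub>R br e (J e) + \<omega> e (J e) *\<^sub>R br f (J f)) x = 0"
    using nz by (simp add: form_linear field_simps)
qed

text \<open>
  The two wedge relations give, for every linear form, an equality between the squares of its
  values on \<open>p\<close>, \<open>C\<close>, \<open>D\<close>, \<open>B\<close> and \<open>J B\<close>, which span the derived algebra. If \<open>B = 0\<close>, take \<open>p\<close> as the
  generator; if \<open>B \<noteq> 0\<close>, take \<open>B\<close> and \<open>J B\<close>. In the first case, and in the second if \<open>k > 0\<close>
  (a definite metric), a form that vanishes on the chosen generators vanishes on all five. If
  \<open>k < 0\<close>, this is true after \<open>p\<close> has changed sides: then \<open>C\<close> and \<open>D\<close> span everything, and
  \<open>B\<close>, \<open>J B\<close> span the same plane as soon as \<open>B \<noteq> 0\<close>.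
\<close>

lemma derived_algebra_in_complex_line:
  assumes dim: "DIM('a) = 4" and uni: "unimodular br"
  shows "\<exists>b. b \<noteq> 0 \<and> (\<forall>x y. br x y \<in> span {b, J b})"
proof -
  obtain e f where frame: "adapted_frame e f" using adapted_frame_exists[OF dim] by blast
  then have nz: "\<omega> e (J e) \<noteq> 0" "\<omega> f (J f) \<noteq> 0" by (simp_all add: adapted_frame_def)
  define k where "k = \<omega> f (J f) / \<omega> e (J e)"
  have "k \<noteq> 0" using nz by (simp add: k_def)
  define p where "p = br e (J e)"
  have p': "br f (J f) = - (k *\<^sub>R p)"
  proof -
    have "\<omega> e (J e) *\<^sub>R (br f (J f) + k *\<^sub>R p) = 0"
      using adapted_frame_contraction[OF dim uni frame] nz(1)
      by (simp add: k_def p_def scaleR_add_right add.commute)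
    then show ?thesis using nz(1) by (simp add: eq_neg_iff_add_eq_0)
  qed
  define B C D where "B = br e (J f) + br (J e) f" and "C = br (J e) (J f) + br e f"
    and "D = br (J e) f - br e (J f)"
  have JB: "J B = br (J e) (J f) - br e f"
    using integrable_J[of e f] by (simp add: B_def J_linear algebra_simps)
  have key: "4 * k * (z \<bullet> p)\<^sup>2 + (z \<bullet> C)\<^sup>2 + (z \<bullet> D)\<^sup>2 = (z \<bullet> J B)\<^sup>2 + (z \<bullet> B)\<^sup>2" for z
  proof -
    note lin = linear_form_coordinate
    have "(z \<bullet> p) * (z \<bullet> br f (J f)) - (z \<bullet> br e f) * (z \<bullet> br (J e) (J f))
        + (z \<bullet> br e (J f)) * (z \<bullet> br (J e) f) = 0"
      unfolding p_def
      by (rule exact_form_square_zero[OF uni lin(1) lin(2) lin(1) lin(2)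
            adapted_frame_expansion[OF dim frame]])
    then show ?thesis
      unfolding JB unfolding B_def C_def D_def p'
      by (simp add: inner_add_right inner_diff_right power2_eq_square algebra_simps)
  qed
  have gen: "br x y \<in> V"
    if V: "subspace V" "p \<in> V" "B \<in> V" "J B \<in> V" "C \<in> V" "D \<in> V" for V x y
  proof -
    note sub = subspace_add[OF V(1)] subspace_scale[OF V(1)] subspace_neg[OF V(1)] subspace_0[OF V(1)]
      subspace_diff[OF V(1)]
    have "br e f = (1/2) *\<^sub>R (C - J B)" "br (J e) (J f) = (1/2) *\<^sub>R (C + J B)"
      "br e (J f) = (1/2) *\<^sub>R (B - D)" "br (J e) f = (1/2) *\<^sub>R (B + D)"
      unfolding JB unfolding B_def C_def D_def by (simp_all flip: scaleR_2)
    then have "br e f \<in> V" "br (J e) (J f) \<in> V" "br e (J f) \<in> V" "br (J e) f \<in> V"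
      "br e (J e) \<in> V" "br f (J f) \<in> V"
      using V(2-) p' by (simp_all add: sub p_def)
    moreover from this have "br f e \<in> V" "br (J f) (J e) \<in> V" "br (J f) e \<in> V" "br f (J e) \<in> V"
      "br (J e) e \<in> V" "br (J f) f \<in> V"
      using sub(3) br_swap by metis+
    ultimately have "br u y \<in> V" if "u \<in> {e, J e, f, J f}" for u
      using that
      by (subst adapted_frame_expansion[OF dim frame, of y]) (auto simp: br_linear br_self sub)
    then show ?thesis
      by (subst adapted_frame_expansion[OF dim frame, of x]) (simp add: br_linear sub)
  qed
  have "\<exists>b. b \<noteq> 0 \<and> p \<in> span {b, J b} \<and> B \<in> span {b, J b} \<and> J B \<in> span {b, J b}
      \<and> C \<in> span {b, J b} \<and> D \<in> span {b, J b}"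
  proof (cases "B = 0")
    case True
    have CD: "z \<bullet> C = 0 \<and> z \<bullet> D = 0" if "z \<bullet> p = 0" for z
      using key[of z] that True by (simp add: J_linear sum_power2_eq_zero_iff)
    have "C \<in> span {p}" "D \<in> span {p}"
      using CD by (auto intro!: mem_span_if_annihilated)
    then have *: "C \<in> span {p, J p}" "D \<in> span {p, J p}"
      using span_mono[of "{p}" "{p, J p}"] by auto
    show ?thesis
    proof (cases "p = 0")
      case True
      \<comment> \<open>The algebra is abelian and every complex line will do.\<close>
      obtain b0 :: 'a where "b0 \<in> Basis" using nonempty_Basis by blast
      then have "b0 \<noteq> 0" using nonzero_Basis by blast
      then show ?thesis using True \<open>B = 0\<close> * by (auto simp: J_linear span_zero)
    next
      case False
      then show ?thesis using \<open>B = 0\<close> * by (auto simp: J_linear span_zero span_base)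
    qed
  next
    case False
    have "p \<in> span {B, J B} \<and> C \<in> span {B, J B} \<and> D \<in> span {B, J B}"
    proof (cases "k > 0")
      case True
      have "z \<bullet> p = 0 \<and> z \<bullet> C = 0 \<and> z \<bullet> D = 0" if "z \<bullet> B = 0" "z \<bullet> J B = 0" for z
      proof -
        have "4 * k * (z \<bullet> p)\<^sup>2 + (z \<bullet> C)\<^sup>2 + (z \<bullet> D)\<^sup>2 = 0" using key[of z] that by simp
        moreover have "4 * k * (z \<bullet> p)\<^sup>2 \<ge> 0" using True by simp
        ultimately have "4 * k * (z \<bullet> p)\<^sup>2 = 0" "(z \<bullet> C)\<^sup>2 = 0" "(z \<bullet> D)\<^sup>2 = 0"
          using zero_le_power2[of "z \<bullet> C"] zero_le_power2[of "z \<bullet> D"] by linarith+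
        with True show ?thesis by simp
      qed
      then show ?thesis by (auto intro!: mem_span_if_annihilated)
    next
      case k: False
      have "z \<bullet> p = 0 \<and> z \<bullet> B = 0 \<and> z \<bullet> J B = 0" if "z \<bullet> C = 0" "z \<bullet> D = 0" for z
      proof -
        have "4 * k * (z \<bullet> p)\<^sup>2 = (z \<bullet> J B)\<^sup>2 + (z \<bullet> B)\<^sup>2" using key[of z] that by simp
        moreover have "4 * k * (z \<bullet> p)\<^sup>2 \<le> 0" using k by (simp add: mult_nonpos_nonneg)
        ultimately have "4 * k * (z \<bullet> p)\<^sup>2 = 0" "(z \<bullet> J B)\<^sup>2 = 0" "(z \<bullet> B)\<^sup>2 = 0"
          using zero_le_power2[of "z \<bullet> J B"] zero_le_power2[of "z \<bullet> B"] by linarith+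
        with \<open>k \<noteq> 0\<close> show ?thesis by simp
      qed
      then have in_CD: "p \<in> span {C, D}" "B \<in> span {C, D}" "J B \<in> span {C, D}"
        by (auto intro!: mem_span_if_annihilated)
      have "span {B, J B} = span {C, D}"
      proof (rule subspace_dim_equal)
        show "span {B, J B} \<subseteq> span {C, D}" using in_CD by (intro span_minimal) auto
        show "dim (span {C, D}) \<le> dim (span {B, J B})"
          using dim_span_pair_le[of C D] complex_line_dim[OF False] by simp
      qed simp_all
      then show ?thesis using in_CD by (auto simp: span_base)
    qed
    then show ?thesis using False by (auto simp: span_base)
  qed
  then show ?thesis using gen[OF subspace_span] by metis
qed

section \<open>The action on the complex line\<close>

text \<open>
  In the basis \<open>b, J b\<close>, the operator \<open>ad x\<close> has columns \<open>(x1, x2)\<close> and \<open>(x3, -x1)\<close>, by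
  unimodularity. Split it into its complex linear part, a multiple of \<open>J\<close>, and its complex
  antilinear part. Integrability says that the antilinear part for \<open>J x\<close> is \<open>J\<close> times that for \<open>x\<close>;
  as \<open>ad x\<close> and \<open>ad (J x)\<close> commute on the line, the square of the antilinear part is zero, and
  with it the part itself.
\<close>

lemma derived_line_action:
  assumes uni: "unimodular br" and b: "b \<noteq> 0" and V: "\<And>x y. br x y \<in> span {b, J b}"
  obtains a where "linear a" "\<And>x v. v \<in> span {b, J b} \<Longrightarrow> br x v = a x *\<^sub>R J v"
    "\<And>v. v \<in> span {b, J b} \<Longrightarrow> a v = 0"
proof -
  obtain \<alpha> \<beta> where lin: "linear \<alpha>" "linear \<beta>"
    and coord: "\<And>v. v \<in> span {b, J b} \<Longrightarrow> v = \<alpha> v *\<^sub>R b + \<beta> v *\<^sub>R J b"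
    using complex_line_coordinates[OF b] by metis
  define x1 where "x1 x = \<alpha> (br x b)" for x
  define x2 where "x2 x = \<beta> (br x b)" for x
  define x3 where "x3 x = \<alpha> (br x (J b))" for x
  have trace: "\<beta> (br x (J b)) = - x1 x" for x
  proof -
    have "endo_trace (\<lambda>y. br x y)
        = endo_trace (\<lambda>y. \<alpha> (br x y) *\<^sub>R b + \<beta> (br x y) *\<^sub>R J b)"
      by (rule arg_cong[where f = endo_trace], rule ext) (rule coord[OF V])
    then show ?thesis
      using uni by (simp add: unimodular_def endo_trace_add endo_trace_rank_one linear_coordinate_ad lin x1_def)
  qed
  have act_b: "br x b = x1 x *\<^sub>R b + x2 x *\<^sub>R J b" for x
    using coord[OF V] by (simp add: x1_def x2_def)
  have act_Jb: "br x (J b) = x3 x *\<^sub>R b - x1 x *\<^sub>R J b" for x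
    using coord[OF V, of x "J b"] trace[of x] by (simp add: x3_def)
  note zero = complex_multiple_eq_zero[OF b]
  have b_b: "x1 b = 0" "x2 b = 0"
    using zero[of "x1 b" "x2 b"] act_b[of b] by (simp_all add: br_self)
  have Jb_Jb: "x3 (J b) = 0" "x1 (J b) = 0"
    using zero[of "x3 (J b)" "- x1 (J b)"] act_Jb[of "J b"] by (simp_all add: br_self)
  have b_Jb: "x3 b = 0" "x2 (J b) = 0"
  proof -
    have "br b (J b) + br (J b) b = 0" by (simp add: br_swap[of "J b" b])
    then have "x3 b *\<^sub>R b + x2 (J b) *\<^sub>R J b = 0"
      using b_b Jb_Jb by (simp add: act_b act_Jb)
    then show "x3 b = 0" "x2 (J b) = 0" using zero by blast+
  qed
  have line: "\<exists>r s. v = r *\<^sub>R b + s *\<^sub>R J b" if "v \<in> span {b, J b}" for v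
    using coord[OF that] by blast
  have "br b b = 0" "br b (J b) = 0" "br (J b) b = 0" "br (J b) (J b) = 0"
    by (simp_all add: act_b act_Jb b_b Jb_Jb b_Jb)
  then have abelian: "br v m = 0" if "v \<in> span {b, J b}" "m \<in> {b, J b}" for v m
    using line[OF that(1)] that(2) by (auto simp: br_linear)
  have comm: "br x (br y m) = br y (br x m)" if m: "m \<in> {b, J b}" for x y m
  proof -
    have "br m (br x y) = 0" using abelian[OF V[of x y] m] br_swap[of m "br x y"] by simp
    then show ?thesis
      using jacobi[of x y m] br_swap[of m x] by (simp add: br_linear)
  qed
  \<comment> \<open>Commuting traceless \<open>2 \<times> 2\<close> matrices are proportional.\<close>
  have c12: "x1 y * x2 x = x1 x * x2 y" for x y
  proof -
    let ?r = "x1 y * x2 x - x1 x * x2 y"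
    have "(x2 y * x3 x - x2 x * x3 y) *\<^sub>R b + (?r *\<^sub>R J b + ?r *\<^sub>R J b)
        = br x (br y b) - br y (br x b)"
      by (simp add: act_b act_Jb br_linear algebra_simps)
    also have "\<dots> = 0" by (simp add: comm[of b x y])
    finally have "?r + ?r = 0" using zero[of _ "?r + ?r"] unfolding scaleR_add_left by blast
    then show ?thesis by simp
  qed
  have c13: "x1 y * x3 x = x1 x * x3 y" for x y
  proof -
    let ?r = "x1 x * x3 y - x1 y * x3 x"
    have "(?r *\<^sub>R b + ?r *\<^sub>R b) + (x2 x * x3 y - x2 y * x3 x) *\<^sub>R J b
        = br x (br y (J b)) - br y (br x (J b))"
      by (simp add: act_b act_Jb br_linear algebra_simps)
    also have "\<dots> = 0" by (simp add: comm[of "J b" x y])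
    finally have "?r + ?r = 0" using zero[of "?r + ?r"] unfolding scaleR_add_left by blast
    then show ?thesis by simp
  qed
  have int: "x2 (J x) + x3 (J x) = 2 * x1 x" "x2 x + x3 x = - 2 * x1 (J x)" for x
  proof -
    let ?r = "x3 (J x) - x1 x" and ?r' = "x2 (J x) - x1 x"
      and ?s = "x1 (J x) + x2 x" and ?s' = "x1 (J x) + x3 x"
    have "(?r *\<^sub>R b + ?r' *\<^sub>R b) + - (?s *\<^sub>R J b + ?s' *\<^sub>R J b) = 0"
      using integrable_J[of x b] by (simp add: act_b act_Jb J_linear algebra_simps)
    then have "?r + ?r' = 0 \<and> - (?s + ?s') = 0"
      unfolding scaleR_add_left[symmetric] scaleR_minus_left[symmetric] by (rule zero)
    then show "x2 (J x) + x3 (J x) = 2 * x1 x" "x2 x + x3 x = - 2 * x1 (J x)"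
      by linarith+
  qed
  have skew: "x1 x = 0 \<and> x3 x = - x2 x" for x
  proof -
    have "x1 x * (x2 (J x) + x3 (J x)) = x1 (J x) * (x2 x + x3 x)"
      using c12[of x "J x"] c13[of x "J x"] by (simp add: algebra_simps)
    then have "x1 x * (2 * x1 x) = x1 (J x) * (- 2 * x1 (J x))"
      by (simp only: int(1)[of x] int(2)[of x])
    then have "2 * (x1 x)\<^sup>2 = - (2 * (x1 (J x))\<^sup>2)"
      by (simp only: power2_eq_square mult_minus_left mult_minus_right mult.left_commute[of _ 2])
    then have "(x1 x)\<^sup>2 + (x1 (J x))\<^sup>2 = 0" by linarith
    then have "x1 x = 0" "x1 (J x) = 0" by (simp_all add: sum_power2_eq_zero_iff)
    then show ?thesis using int(2)[of x] by simp
  qed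
  show ?thesis
  proof (rule that)
    show "linear x2"
      unfolding x2_def by (rule linearI)
        (simp_all add: br_linear linear_add[OF lin(2)] linear_cmul[OF lin(2)])
    show "br x v = x2 x *\<^sub>R J v" if "v \<in> span {b, J b}" for x v
      using line[OF that] skew[of x]
      by (auto simp: br_linear act_b act_Jb J_linear algebra_simps)
    show "x2 v = 0" if "v \<in> span {b, J b}" for v
      using line[OF that] b_b Jb_Jb b_Jb linear_add[OF \<open>linear x2\<close>] linear_cmul[OF \<open>linear x2\<close>]
      by auto
  qed
qed

section \<open>The Levi-Civita connection\<close>

abbreviation nabla :: "'a \<Rightarrow> 'a \<Rightarrow> 'a" where
  "nabla \<equiv> levi_civita br (pseudo_kahler_metric J \<omega>)"

lemma koszul:
  "2 * \<omega> (J (nabla x y)) z = \<omega> (J (br x y)) z - \<omega> (J (br y z)) x + \<omega> (J (br z x)) y"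
  using pseudo_kahler_koszul[of x y z] by (simp add: pseudo_kahler_metric_def)

lemma nabla_eqI:
  assumes "\<And>z. 2 * \<omega> (J w) z = \<omega> (J (br x y)) z - \<omega> (J (br y z)) x + \<omega> (J (br z x)) y"
  shows "nabla x y = w"
proof -
  have "2 * \<omega> (J (nabla x y)) z = 2 * \<omega> (J w) z" for z
    unfolding assms by (rule koszul)
  then have "J (nabla x y) = J w" by (intro form_eqI) simp
  then have "J (J (nabla x y)) = J (J w)" by simp
  then show ?thesis by (simp add: J_J)
qed

lemma bilinear_nabla: "bilinear nabla"
  unfolding bilinear_def
  by (intro allI conjI linearI; rule nabla_eqI;
      simp add: J_linear form_linear br_linear distrib_left mult.left_commute[of 2] koszul;
      simp add: algebra_simps)

lemma nabla_torsion_free: "nabla x y = nabla y x + br x y"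
proof (rule nabla_eqI)
  fix z
  show "2 * \<omega> (J (nabla y x + br x y)) z
      = \<omega> (J (br x y)) z - \<omega> (J (br y z)) x + \<omega> (J (br z x)) y"
    using koszul[of y x z] br_swap[of y x] br_swap[of z y] br_swap[of x z]
    by (simp add: J_linear form_linear)
qed

text \<open>
  An isotropic plane of a symplectic space of dimension four is Lagrangian: it equals its own
  orthogonal.
\<close>

lemma isotropic_line_orthogonal:
  assumes dim: "DIM('a) = 4" and b: "b \<noteq> 0" "\<omega> b (J b) = 0"
    and v: "\<omega> b v = 0" "\<omega> (J b) v = 0"
  shows "v \<in> span {b, J b}"
proof -
  \<comment> \<open>\<open>G\<close> represents \<open>\<omega>\<close> by the inner product, so that dimensions of orthogonal complements apply.\<close>
  define G where "G k = (\<Sum>i\<in>Basis. \<omega> k i *\<^sub>R i)" for k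
  have G: "G k \<bullet> y = \<omega> k y" for k y
  proof -
    have "\<omega> k y = \<omega> k (\<Sum>i\<in>Basis. (y \<bullet> i) *\<^sub>R i)" by (simp add: euclidean_representation)
    also have "\<dots> = (\<Sum>i\<in>Basis. (y \<bullet> i) * \<omega> k i)"
      using bilinear_form by (simp add: bilinear_def linear_sum linear_cmul)
    also have "\<dots> = (\<Sum>i\<in>Basis. \<omega> k i * (i \<bullet> y))"
      by (simp add: inner_commute mult.commute)
    finally show ?thesis by (simp add: G_def inner_sum_left)
  qed
  have linG: "linear G"
    by (rule linearI) (simp_all add: G_def form_linear scaleR_add_left sum.distrib scaleR_sum_right)
  have injG: "inj G"
    unfolding linear_injective_0[OF linG] using G nondegenerate_form by (metis inner_zero_left)
  let ?K = "span {b, J b}" and ?U = "{y \<in> UNIV. \<forall>x\<in>G ` span {b, J b}. orthogonal x y}"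
  have U: "?U = {y. \<omega> b y = 0 \<and> \<omega> (J b) y = 0}"
  proof -
    have "(\<forall>x\<in>?K. \<omega> x y = 0) \<longleftrightarrow> \<omega> b y = 0 \<and> \<omega> (J b) y = 0" for y
    proof -
      have "subspace {x. \<omega> x y = 0}" by (auto simp: subspace_def form_linear)
      then have "{b, J b} \<subseteq> {x. \<omega> x y = 0} \<longleftrightarrow> ?K \<subseteq> {x. \<omega> x y = 0}"
        by (metis span_minimal span_superset subset_trans)
      then show ?thesis by auto
    qed
    then show ?thesis by (simp add: orthogonal_def G)
  qed
  have "dim (G ` ?K) = 2"
    using dim_image_eq[OF linG] injG complex_line_dim[OF b(1)] by (metis inj_on_subset subset_UNIV)
  then have "dim ?U + 2 = 4"
    using dim_subspace_orthogonal_to_vectors[of "G ` ?K" UNIV] dim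
    by (simp add: linear_subspace_image[OF linG])
  moreover have "?K \<subseteq> ?U"
    unfolding U using b(2) form_swap[of "J b" b]
    by (intro span_minimal) (auto simp: subspace_def form_linear alternating_form)
  moreover have "subspace ?U"
    unfolding U by (auto simp: subspace_def form_linear)
  ultimately have "?K = ?U"
    using complex_line_dim[OF b(1)] by (intro subspace_dim_equal) simp_all
  then show ?thesis using v unfolding U by blast
qed

text \<open>
  For \<open>m\<close> in the line, \<open>\<omega> m\<close> vanishes on brackets, so closedness reads
  \<open>a y * \<omega> m x = a x * \<omega> m y\<close>. If \<open>a\<close> were not zero, both \<open>\<omega> b\<close> and \<open>\<omega> (J b)\<close> would be multiples
  of \<open>a\<close>, against nondegeneracy. So the line is central, and every term of the Koszul formula
  vanishes if one of \<open>x\<close>, \<open>y\<close>, \<open>z\<close> lies in the line: the bracket does, or the form pairs two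
  elements of the line.
\<close>

lemma nabla_isotropic_case:
  assumes dim: "DIM('a) = 4" and b: "b \<noteq> 0" and V: "\<And>x y. br x y \<in> span {b, J b}"
    and a: "\<And>x v. v \<in> span {b, J b} \<Longrightarrow> br x v = a x *\<^sub>R J v"
    and iso: "\<omega> b (J b) = 0"
  shows "nabla (nabla x y) z = 0" "nabla x (nabla y z) = 0"
proof -
  let ?K = "span {b, J b}"
  have isoK: "\<omega> u v = 0" if "u \<in> ?K" "v \<in> ?K" for u v
    using that iso form_swap[of "J b" b] unfolding span_insert span_singleton
    by (auto simp: form_linear alternating_form algebra_simps)
  note JK = complex_line_J[of _ b]
  have inK: "b \<in> ?K" "J b \<in> ?K" by (simp_all add: span_base)
  have a_prop: "a y * \<omega> m x = a x * \<omega> m y" if m: "m \<in> {b, J b}" for m x y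
  proof -
    have Jm: "J m \<in> ?K" using m JK inK by blast
    have "J (J m) \<in> ?K" using JK[OF Jm] .
    have "\<omega> (br x y) (J m) = 0" using isoK[OF V Jm] .
    then have "a y * \<omega> (J (J m)) x - a x * \<omega> (J (J m)) y = 0"
      using closed_form[of x y "J m"] a[OF Jm] br_swap[of "J m" x]
      by (simp add: form_linear)
    then show ?thesis by (simp add: J_linear form_linear)
  qed
  have a0: "a y = 0" for y
  proof (rule ccontr)
    assume y: "a y \<noteq> 0"
    \<comment> \<open>\<open>\<omega> b\<close> and \<open>\<omega> (J b)\<close> are multiples of \<open>a\<close>; their values at \<open>y\<close> show which combination is zero.\<close>
    let ?w = "\<omega> (J b) y *\<^sub>R b + (- \<omega> b y) *\<^sub>R J b"
    have "?w = 0"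
    proof (rule nondegenerate_form)
      fix x
      have "a y * \<omega> ?w x = \<omega> (J b) y * (a y * \<omega> b x) - \<omega> b y * (a y * \<omega> (J b) x)"
        by (simp add: form_linear algebra_simps)
      also have "\<dots> = 0" by (simp add: a_prop[of _ y x])
      finally show "\<omega> ?w x = 0" using y by simp
    qed
    then have "\<omega> b y = 0" using complex_multiple_eq_zero[OF b, of "\<omega> (J b) y" "- \<omega> b y"] by simp
    then have "\<omega> b x = 0" for x using a_prop[of b y x] y by simp
    then show False using nondegenerate_form b by blast
  qed
  have central: "br x v = 0" "br v x = 0" if "v \<in> ?K" for x v
    using a[OF that] br_swap[of x v] a0 by simp_all
  have nabla_in: "nabla x y \<in> ?K" for x y
  proof -
    have "\<omega> z (J (nabla x y)) = 0" if "z \<in> ?K" for z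
      using koszul[of x y z] isoK[OF JK[OF V] that] central[OF that] form_swap[of z]
      by (simp add: J_linear form_linear)
    then have "J (nabla x y) \<in> ?K"
      using isotropic_line_orthogonal[OF dim b iso] inK by blast
    then have "- J (J (nabla x y)) \<in> ?K" using JK span_neg by blast
    then show ?thesis by (simp add: J_J)
  qed
  have nabla_K: "nabla v y = 0" "nabla y v = 0" if "v \<in> ?K" for v y
    using isoK[OF JK[OF V] that] central[OF that]
    by (auto intro!: nabla_eqI simp: J_linear form_linear)
  show "nabla (nabla x y) z = 0" "nabla x (nabla y z) = 0"
    using nabla_K[OF nabla_in] by simp_all
qed

text \<open>
  The brackets of the complement of the line lie in the line, and by closedness they are
  orthogonal to it, so the complement is abelian. Thus
  \<open>[x, y] = a x *\<^sub>R J (P y) - a y *\<^sub>R J (P x)\<close>, and the Koszul formula gives the connection with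
  \<open>T = J \<circ> P\<close>.
\<close>

lemma nabla_nondegenerate_case:
  assumes V: "\<And>x y. br x y \<in> span {b, J b}"
    and a: "linear a" "\<And>x v. v \<in> span {b, J b} \<Longrightarrow> br x v = a x *\<^sub>R J v"
    "\<And>v. v \<in> span {b, J b} \<Longrightarrow> a v = 0"
    and h: "\<omega> b (J b) \<noteq> 0"
  obtains T where "\<And>x y. nabla x y = a x *\<^sub>R T y" "linear T" "\<And>x. a (T x) = 0" "\<And>x. T (T (T x)) = - T x"
proof -
  let ?K = "span {b, J b}" and ?h = "\<omega> b (J b)"
  note JK = complex_line_J[of _ b]
  have inK: "b \<in> ?K" "J b \<in> ?K" by (simp_all add: span_base)
  define P where "P x = (\<omega> x (J b) / ?h) *\<^sub>R b + (\<omega> b x / ?h) *\<^sub>R J b" for x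
  have linP: "linear P"
    by (rule linearI) (simp_all add: P_def form_linear add_divide_distrib scaleR_add_left algebra_simps)
  have PK: "P x \<in> ?K" for x
    by (simp add: P_def span_add span_mul inK)
  have P_id: "P v = v" if "v \<in> ?K" for v
    using that h unfolding span_insert span_singleton
    by (auto simp: P_def form_linear alternating_form algebra_simps)
  have P_comp: "\<omega> v (x - P x) = 0" if "v \<in> ?K" for v x
    using that h form_swap[of "J b" b] form_swap[of x "J b"] unfolding span_insert span_singleton
    by (auto simp: P_def form_linear alternating_form algebra_simps)
  have P_skew: "\<omega> (P x) y = - \<omega> (P y) x" for x y
    using h form_swap[of x "J b"] form_swap[of y "J b"]
    by (simp add: P_def form_linear field_simps)
  have a_comp: "a (x - P x) = a x" for x
    using a(3)[OF PK] by (simp add: linear_diff[OF a(1)])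
  have comp_comm: "br (x - P x) (y - P y) = 0" for x y
  proof -
    let ?c = "br (x - P x) (y - P y)"
    have "\<omega> ?c v = 0" if v: "v \<in> ?K" for v
      using closed_form[of "x - P x" "y - P y" v] br_swap[of v "x - P x"]
        P_comp[OF JK[OF v]] a(2)[OF v]
      by (simp only: form_linear) simp
    then have "P ?c = 0" using inK form_swap[of b ?c] by (simp add: P_def)
    then show ?thesis using P_id[OF V] by simp
  qed
  have br_formula: "br x y = a x *\<^sub>R J (P y) - a y *\<^sub>R J (P x)" for x y
  proof -
    have "br x y = br (x - P x) (y - P y) + br (x - P x) (P y) + br (P x) y"
      by (simp add: br_linear)
    also have "br (x - P x) (P y) = a x *\<^sub>R J (P y)"
      by (simp only: a(2)[OF PK] a_comp)
    also have "br (P x) y = - (a y *\<^sub>R J (P x))"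
      using br_swap[of "P x" y] a(2)[OF PK, of y x] by simp
    finally show ?thesis by (simp add: comp_comm)
  qed
  define T where "T x = J (P x)" for x
  have TK: "T x \<in> ?K" for x by (simp add: T_def JK PK)
  show ?thesis
  proof (rule that)
    show "nabla x y = a x *\<^sub>R T y" for x y
    proof (rule nabla_eqI)
      fix z
      show "2 * \<omega> (J (a x *\<^sub>R T y)) z
          = \<omega> (J (br x y)) z - \<omega> (J (br y z)) x + \<omega> (J (br z x)) y"
        using P_skew[of z y] P_skew[of z x] P_skew[of y x]
        by (simp add: br_formula T_def J_linear form_linear algebra_simps)
    qed
    show "linear T"
      unfolding T_def using linear_compose[OF linP linear_J] by (simp add: o_def)
    show "a (T x) = 0" for x by (rule a(3)[OF TK])
    have TT: "T (T x) = - P x" for x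
      unfolding T_def[of "T x"] P_id[OF TK] by (simp add: T_def J_J)
    show "T (T (T x)) = - T x" for x
      unfolding TT[of "T x"] P_id[OF TK] ..
  qed
qed

text \<open>
  The common outcome of the two cases, and all that flatness and completeness need. In the
  isotropic case \<open>c = 0\<close>; in the other case \<open>c = a x\<close>.
\<close>

lemma nabla_structure:
  assumes dim: "DIM('a) = 4" and uni: "unimodular br"
  shows "nabla (nabla x y) z = 0"
    and "nabla x (nabla y z) = nabla y (nabla x z)"
    and "\<exists>c. \<forall>y. nabla x (nabla x (nabla x y)) = - (c\<^sup>2) *\<^sub>R nabla x y"
proof -
  obtain b where b: "b \<noteq> 0" and V: "\<And>x y. br x y \<in> span {b, J b}"
    using derived_algebra_in_complex_line[OF dim uni] by blast
  obtain a where a: "linear a" "\<And>x v. v \<in> span {b, J b} \<Longrightarrow> br x v = a x *\<^sub>R J v"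
    "\<And>v. v \<in> span {b, J b} \<Longrightarrow> a v = 0"
    using derived_line_action[OF uni b V] by metis
  have "nabla (nabla x y) z = 0 \<and> nabla x (nabla y z) = nabla y (nabla x z) \<and>
    (\<exists>c. \<forall>y. nabla x (nabla x (nabla x y)) = - (c\<^sup>2) *\<^sub>R nabla x y)"
  proof (cases "\<omega> b (J b) = 0")
    case True
    note N = nabla_isotropic_case[OF dim b V a(2) True]
    have "nabla u 0 = 0" for u using bilinear_rzero[OF bilinear_nabla] by blast
    then have "nabla x (nabla x (nabla x y)) = - (0\<^sup>2) *\<^sub>R nabla x y" for y by (simp add: N(2))
    then show ?thesis using N by metis
  next
    case False
    obtain T where T: "\<And>x y. nabla x y = a x *\<^sub>R T y" "linear T" "\<And>x. a (T x) = 0"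
      "\<And>x. T (T (T x)) = - T x"
      using nabla_nondegenerate_case[OF V a False] by metis
    have "nabla x (nabla x (nabla x y)) = - ((a x)\<^sup>2) *\<^sub>R nabla x y" for y
      by (simp add: T(1) linear_cmul[OF T(2)] T(4) power2_eq_square)
    then show ?thesis
      by (auto simp: T(1,3) linear_cmul[OF T(2)] linear_cmul[OF a(1)] mult.commute)
  qed
  then show "nabla (nabla x y) z = 0" "nabla x (nabla y z) = nabla y (nabla x z)"
    "\<exists>c. \<forall>y. nabla x (nabla x (nabla x y)) = - (c\<^sup>2) *\<^sub>R nabla x y"
    by blast+
qed

end

section \<open>Completeness of connections with linear geodesic equation\<close>

text \<open>
  If \<open>M\<close> satisfies \<open>M\<^sup>3 = - c\<^sup>2 M\<close>, then \<open>1 + s t M + k t M\<^sup>2\<close> is the exponential of \<open>t M\<close>. The last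
  equation says that changing the sign of \<open>s\<close> inverts it.
\<close>

lemma flow_coefficients:
  fixes c :: real
  obtains s k :: "real \<Rightarrow> real"
  where "\<And>t. (s has_real_derivative 1 - c\<^sup>2 * k t) (at t)" "\<And>t. (k has_real_derivative s t) (at t)"
    "\<And>t. 2 * k t = (s t)\<^sup>2 + c\<^sup>2 * (k t)\<^sup>2"
proof (cases "c = 0")
  case True
  show ?thesis
    by (rule that[of "\<lambda>t. t" "\<lambda>t. t\<^sup>2 / 2"])
      (auto simp: True intro!: derivative_eq_intros)
next
  case False
  show ?thesis
  proof (rule that[of "\<lambda>t. sin (c * t) / c" "\<lambda>t. (1 - cos (c * t)) / c\<^sup>2"])
    fix t
    show "((\<lambda>t. sin (c * t) / c) has_real_derivative 1 - c\<^sup>2 * ((1 - cos (c * t)) / c\<^sup>2)) (at t)"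
      "((\<lambda>t. (1 - cos (c * t)) / c\<^sup>2) has_real_derivative sin (c * t) / c) (at t)"
      using False by (auto intro!: derivative_eq_intros simp: power2_eq_square)
    have "(sin (c * t))\<^sup>2 = 1 - (cos (c * t))\<^sup>2" by (rule sin_squared_eq)
    then show "2 * ((1 - cos (c * t)) / c\<^sup>2)
        = (sin (c * t) / c)\<^sup>2 + c\<^sup>2 * ((1 - cos (c * t)) / c\<^sup>2)\<^sup>2"
      using False by (simp add: power_divide) (simp add: field_simps power2_eq_square power4_eq_xxxx)
  qed
qed

text \<open>
  The derivative of \<open>D (x t) v\<close> along a geodesic \<open>x\<close> is \<open>- D (D (x t) (x t)) v = 0\<close>. So \<open>x\<close> solves the
  linear equation \<open>x' = - M x\<close> with the constant operator \<open>M = D (x t0)\<close>, and it is the restriction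
  of an orbit of the flow of \<open>- M\<close>. That orbit moves only in the range of \<open>M\<close>, so \<open>D\<close> stays
  constant along it and it is a geodesic for all times.
\<close>

lemma geodesically_complete_if_constant_along_geodesics:
  fixes D :: "'a::euclidean_space \<Rightarrow> 'a \<Rightarrow> 'a"
  assumes D: "bilinear D" and DD: "\<And>x y z. D (D x y) z = 0"
    and cubic: "\<And>x. \<exists>c. \<forall>y. D x (D x (D x y)) = - (c\<^sup>2) *\<^sub>R D x y"
  shows "geodesically_complete D"
  unfolding geodesically_complete_def
proof (intro allI impI)
  fix S :: "real set" and x
  assume "open S \<and> is_interval S \<and> geodesic_on D S x"
  then have S: "open S" "connected S"
    and x: "\<And>t. t \<in> S \<Longrightarrow> (x has_vector_derivative - D (x t) (x t)) (at t)"
    by (auto simp: geodesic_on_def is_interval_connected_1)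
  note D_linear = bilinear_ladd[OF D] bilinear_radd[OF D] bilinear_lmul[OF D] bilinear_rmul[OF D]
    bilinear_lneg[OF D] bilinear_rneg[OF D] bilinear_lsub[OF D] bilinear_rsub[OF D]
    bilinear_lzero[OF D] bilinear_rzero[OF D]
  show "\<exists>y. geodesic_on D UNIV y \<and> (\<forall>t\<in>S. y t = x t)"
  proof (cases "S = {}")
    case True
    then show ?thesis
      by (intro exI[of _ "\<lambda>_. 0"]) (simp add: geodesic_on_def D_linear)
  next
    case False
    then obtain t0 where t0: "t0 \<in> S" by blast
    define M where "M = D (x t0)"
    have linM: "linear M" using D by (simp add: bilinear_def M_def)
    have blM: "bounded_linear M" using linM by (simp add: linear_conv_bounded_linear)
    have D_const: "D (x t) v = M v" if "t \<in> S" for t v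
    proof -
      have bl: "bounded_linear (\<lambda>u. D u v)"
        using D by (simp add: bilinear_def linear_conv_bounded_linear)
      have "((\<lambda>t. D (x t) v) has_derivative (\<lambda>h. 0)) (at t)" if "t \<in> S" for t
        using bounded_linear.has_vector_derivative[OF bl x[OF that]]
        by (simp add: D_linear DD has_vector_derivative_def)
      from has_derivative_zero_unique_connected[OF S this that t0] show ?thesis
        by (simp add: M_def)
    qed
    obtain c where c: "\<And>y. M (M (M y)) = - (c\<^sup>2) *\<^sub>R M y"
      using cubic[of "x t0"] unfolding M_def by blast
    obtain s k where s: "\<And>t. (s has_real_derivative 1 - c\<^sup>2 * k t) (at t)"
      and k: "\<And>t. (k has_real_derivative s t) (at t)"
      and sk: "\<And>t. 2 * k t = (s t)\<^sup>2 + c\<^sup>2 * (k t)\<^sup>2"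
      using flow_coefficients[of c] by metis
    \<comment> \<open>\<open>E r t\<close> is the exponential of \<open>r t M\<close> for \<open>r = 1\<close> and \<open>r = -1\<close>.\<close>
    define E where "E r t v = v + (r * s t) *\<^sub>R M v + k t *\<^sub>R M (M v)" for r t v
    note M_linear = linear_add[OF linM] linear_diff[OF linM] linear_cmul[OF linM] linear_neg[OF linM]
    have inv: "E (-1) t (E 1 t v) = v" for t v
    proof -
      have "E (-1) t (E 1 t v) = v + (k t *\<^sub>R M (M v) + k t *\<^sub>R M (M v))
          - ((s t)\<^sup>2 + c\<^sup>2 * (k t)\<^sup>2) *\<^sub>R M (M v)"
        by (simp add: E_def M_linear c power2_eq_square) (simp add: algebra_simps)
      also have "k t *\<^sub>R M (M v) + k t *\<^sub>R M (M v) = (2 * k t) *\<^sub>R M (M v)"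
        by (simp flip: scaleR_2)
      also have "(2 * k t) *\<^sub>R M (M v) = ((s t)\<^sup>2 + c\<^sup>2 * (k t)\<^sup>2) *\<^sub>R M (M v)"
        by (simp only: sk)
      finally show ?thesis by simp
    qed
    have E': "((\<lambda>t. E 1 t (x t)) has_derivative (\<lambda>h. 0)) (at t)" if "t \<in> S" for t
    proof -
      have x': "(x has_vector_derivative - M (x t)) (at t)"
        using x[OF that] D_const[OF that] by simp
      note Mx' = bounded_linear.has_vector_derivative[OF blM x']
      note MMx' = bounded_linear.has_vector_derivative[OF blM Mx']
      have "((\<lambda>t. x t + s t *\<^sub>R M (x t) + k t *\<^sub>R M (M (x t))) has_vector_derivative
          (- M (x t) + (s t *\<^sub>R M (- M (x t)) + (1 - c\<^sup>2 * k t) *\<^sub>R M (x t))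
           + (k t *\<^sub>R M (M (- M (x t))) + s t *\<^sub>R M (M (x t))))) (at t)"
        by (intro has_vector_derivative_add has_vector_derivative_scaleR x' Mx' MMx' s k)
      then show ?thesis
        by (simp add: E_def M_linear c has_vector_derivative_def algebra_simps)
    qed
    have const: "E 1 t (x t) = E 1 t0 (x t0)" if "t \<in> S" for t
      by (rule has_derivative_zero_unique_connected[OF S E' that t0])
    define v where "v = E 1 t0 (x t0)"
    define y where "y t = E (-1) t v" for t
    have yx: "y t = x t" if "t \<in> S" for t
      unfolding y_def v_def by (simp add: inv flip: const[OF that])
    have y': "(y has_vector_derivative - M (y t)) (at t)" for t
    proof -
      have "((\<lambda>t. v + (- s t) *\<^sub>R M v + k t *\<^sub>R M (M v)) has_vector_derivative
          (0 + ((- s t) *\<^sub>R 0 + (- (1 - c\<^sup>2 * k t)) *\<^sub>R M v) + (k t *\<^sub>R 0 + s t *\<^sub>R M (M v)))) (at t)"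
        by (intro has_vector_derivative_add has_vector_derivative_scaleR
            has_vector_derivative_const s k DERIV_minus)
      then show ?thesis
        unfolding y_def[abs_def] E_def by (simp add: M_linear c algebra_simps)
    qed
    have D_y: "D (y t) w = M w" for t w
    proof -
      \<comment> \<open>\<open>M v\<close> and \<open>M (M v)\<close> are values of \<open>D\<close>.\<close>
      have "D (y t) w = D v w" for t
        by (simp add: y_def E_def D_linear M_def DD)
      then have "D (y t) w = D (y t0) w" by simp
      then show ?thesis by (simp add: yx[OF t0] M_def)
    qed
    have "geodesic_on D UNIV y" using y' by (simp add: geodesic_on_def D_y)
    then show ?thesis using yx by blast
  qed
qed

theorem theorem4p4:
  fixes br :: "'a::euclidean_space \<Rightarrow> 'a \<Rightarrow> 'a"
    and J :: "'a \<Rightarrow> 'a"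
    and \<omega> :: "'a \<Rightarrow> 'a \<Rightarrow> real"
  assumes "DIM('a) = 4"
    and "kahler_lie_algebra br J \<omega>"
    and "unimodular br"
  shows "flat_metric br (pseudo_kahler_metric J \<omega>) \<and>
         geodesically_complete (levi_civita br (pseudo_kahler_metric J \<omega>))"
proof -
  interpret kahler_lie_algebra br J \<omega> by fact
  note N = nabla_structure[OF assms(1,3)]
  have "nabla (br x y) z = 0" for x y z
    using nabla_torsion_free[of x y] N(1)
    by (metis add_diff_cancel_left' bilinear_lsub[OF bilinear_nabla] diff_self)
  then have "flat_metric br (pseudo_kahler_metric J \<omega>)"
    unfolding flat_metric_def curvature_def using N(2) by simp
  moreover have "geodesically_complete nabla"
    by (rule geodesically_complete_if_constant_along_geodesics[OF bilinear_nabla N(1,3)])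
  ultimately show ?thesis by blast
qed

end
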